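(* Let $\mathcal{E}$ be the class of Kalmár elementary functions. Then $$\langle x\mathbin{\dot-}y,\ x\bmod y,\ 2^x\rangle\subsetneqq\mathcal{E}.$$
   Context: $\mathbb{N}$ is the set of non-negative integers. An ($r$-ary, $r\ge 1$) operation on $\mathbb{N}$ is a function $\mathbb{N}^r\to\mathbb{N}$. Truncated subtraction is $x \mathbin{\dot-} y:=\max(x-y,0)$. Conventions: $\lfloor x/0\rfloor:=0$, and $x\bmod y:=x \mathbin{\dot-} y\lfloor x/y\rfloor$, so that $x\bmod 0=x$. A set $S$ of operations on $\mathbb{N}$ is closed under substitution if, whenever $f\in S$ is $r$-ary and $g_1,\dots,g_r\in S$ are $n$-ary, the operation $\vec x\mapsto f(g_1(\vec x),\dots,g_r(\vec x))$ is in $S$. For a set $\mathcal{B}$ of operations on $\mathbb{N}$, $\langle\mathcal{B}\rangle$ denotes the closure under substitution of $\mathcal{B}\cup C\cup P$, where $C$ is the set of all constant operations on $\mathbb{N}$ (of every arity) and $P$ is the set of all projections $(x_1,\dots,x_n)\mapsto x_i$. Here $x\mathbin{\dot-}y$ and $x\bmod y$ denote binary operations and $2^x$ a unary operation. The Kalmár elementary functions, forming the class $\mathcal{E}$, are the elements of the smallest set of operations on $\mathbb{N}$ that contains the constants, the projections, the addition, and the truncated subtraction, and that is closed under substitution, bounded summation ($(\vec x,y)\mapsto\sum_{z<y}f(\vec x,z)$), and bounded multiplication ($(\vec x,y)\mapsto\prod_{z<y}f(\vec x,z)$). *)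

theory Defs
  imports Main "HOL.Hull" "HOL-Library.FuncSet"
begin

text \<open>
  An operation of arity \<open>r \<ge> 1\<close> is encoded as the pair of \<open>r\<close> and a function on lists, restricted to
  the lists of length \<open>r\<close>. The restriction makes the encoding unique, so that equality, membership
  and (strict) inclusion for sets of encoded operations have their usual mathematical meaning.
\<close>

type_synonym operation = "nat \<times> (nat list \<Rightarrow> nat)"

definition oper :: "nat \<Rightarrow> (nat list \<Rightarrow> nat) \<Rightarrow> operation" where
  "oper r f = (r, restrict f {xs. length xs = r})"

definition constants :: "operation set" where
  "constants = {oper r (\<lambda>_. c) | r c. 1 \<le> r}"

definition projections :: "operation set" where
  "projections = {oper n (\<lambda>xs. xs ! i) | n i. i < n}"

definition closed_under_substitution :: "operation set \<Rightarrow> bool" where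
  "closed_under_substitution S \<longleftrightarrow>
    (\<forall>r f n gs. (r, f) \<in> S \<and> length gs = r \<and> (\<forall>g \<in> set gs. (n, g) \<in> S) \<longrightarrow>
      oper n (\<lambda>xs. f (map (\<lambda>g. g xs) gs)) \<in> S)"

text \<open>The bounded variable is the last argument; the list of parameters may be empty.\<close>

definition closed_under_bounded_sum :: "operation set \<Rightarrow> bool" where
  "closed_under_bounded_sum S \<longleftrightarrow>
    (\<forall>k f. (Suc k, f) \<in> S \<longrightarrow>
      oper (Suc k) (\<lambda>xs. \<Sum>z<last xs. f (butlast xs @ [z])) \<in> S)"

definition closed_under_bounded_prod :: "operation set \<Rightarrow> bool" where
  "closed_under_bounded_prod S \<longleftrightarrow>
    (\<forall>k f. (Suc k, f) \<in> S \<longrightarrow>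
      oper (Suc k) (\<lambda>xs. \<Prod>z<last xs. f (butlast xs @ [z])) \<in> S)"

definition generated :: "operation set \<Rightarrow> operation set" where
  "generated B = closed_under_substitution hull (B \<union> constants \<union> projections)"

definition add_op :: operation where
  "add_op = oper 2 (\<lambda>xs. xs ! 0 + xs ! 1)"

text \<open>Subtraction on \<^typ>\<open>nat\<close> is truncated, and \<open>x mod 0 = x\<close> holds for the library's \<open>mod\<close>.\<close>

definition sub_op :: operation where
  "sub_op = oper 2 (\<lambda>xs. xs ! 0 - xs ! 1)"

definition mod_op :: operation where
  "mod_op = oper 2 (\<lambda>xs. xs ! 0 mod xs ! 1)"

definition pow2_op :: operation where
  "pow2_op = oper 1 (\<lambda>xs. 2 ^ (xs ! 0))"

definition kalmar_elementary :: "operation set" where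
  "kalmar_elementary =
    (\<lambda>S. closed_under_substitution S \<and> closed_under_bounded_sum S \<and> closed_under_bounded_prod S)
      hull (constants \<union> projections \<union> {add_op, sub_op})"

end

theory Submission imports Defs
begin

text \<open>
  Neither \<open>x - y\<close> (truncated) nor \<open>x mod y\<close> exceeds \<open>x\<close>, and \<open>2 ^ x\<close> is unary. Hence every
  operation generated by them is bounded by a monotone function of a single one of its arguments, a
  property that survives substitution but fails for addition. Conversely \<open>2 ^ x\<close> is a bounded
  product of constants, and \<open>x mod y\<close> is elementary since
  \<open>y * (x div y) = (\<Sum>z<x. y * (1 - (y * z + y - x)))\<close>.
\<close>

lemma oper_cong:
  assumes "\<And>xs. length xs = r \<Longrightarrow> f xs = g xs"
  shows "oper r f = oper r g"
  using assms by (auto simp: oper_def restrict_def)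

text \<open>Members of an operation set carry restricted functions; this form works with
  unrestricted \<open>f\<close> and \<open>gs\<close>. The restrictions are harmless: each
  \<open>g\<close> is evaluated on lists of length \<open>n\<close> only, and \<open>f\<close> on
  lists of length \<open>length gs\<close> only.\<close>

lemma closed_under_substitutionD:
  assumes "closed_under_substitution S" "oper (length gs) f \<in> S" "\<And>g. g \<in> set gs \<Longrightarrow> oper n g \<in> S"
  shows "oper n (\<lambda>xs. f (map (\<lambda>g. g xs) gs)) \<in> S"
proof -
  let ?R = "\<lambda>n g. restrict g {xs. length xs = n}"
  have "(length gs, ?R (length gs) f) \<in> S" "\<forall>g \<in> set (map (?R n) gs). (n, g) \<in> S"
    using assms(2,3) by (auto simp: oper_def)
  then have "oper n (\<lambda>xs. ?R (length gs) f (map (\<lambda>g. g xs) (map (?R n) gs))) \<in> S"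
    using assms(1) unfolding closed_under_substitution_def by (metis length_map)
  also have "oper n (\<lambda>xs. ?R (length gs) f (map (\<lambda>g. g xs) (map (?R n) gs))) =
      oper n (\<lambda>xs. f (map (\<lambda>g. g xs) gs))"
    by (rule oper_cong) (simp add: comp_def)
  finally show ?thesis .
qed

text \<open>The index \<open>i\<close> is fixed before \<open>xs\<close> is given. If it could vary
  with \<open>xs\<close>, addition would qualify: twice the larger argument bounds the sum.\<close>

definition bounded_by_one_argument :: "operation set" where
  "bounded_by_one_argument =
    {(r, f). \<exists>i G. i < r \<and> mono G \<and> (\<forall>xs. length xs = r \<longrightarrow> f xs \<le> G (xs ! i))}"

lemma oper_bounded_by_one_argumentI:
  assumes "i < r" "mono G" "\<And>xs. length xs = r \<Longrightarrow> f xs \<le> G (xs ! i)"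
  shows "oper r f \<in> bounded_by_one_argument"
  using assms unfolding bounded_by_one_argument_def oper_def by auto

text \<open>The outer operation is controlled by its argument \<open>i\<close> alone, hence by
  \<open>gs ! i\<close>, which is in turn controlled by one argument \<open>j\<close>. Monotonicity
  of \<open>G\<close> lets the two bounds compose.\<close>

lemma closed_under_substitution_bounded_by_one_argument:
  "closed_under_substitution bounded_by_one_argument"
  unfolding closed_under_substitution_def
proof (intro allI impI, elim conjE)
  fix r f n and gs :: "(nat list \<Rightarrow> nat) list"
  assume f: "(r, f) \<in> bounded_by_one_argument" and len: "length gs = r"
    and gs: "\<forall>g\<in>set gs. (n, g) \<in> bounded_by_one_argument"
  from f obtain i G where i: "i < r" and G: "mono G"
    and le: "\<And>ys. length ys = r \<Longrightarrow> f ys \<le> G (ys ! i)"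
    unfolding bounded_by_one_argument_def by auto
  have "(n, gs ! i) \<in> bounded_by_one_argument"
    using gs i len by simp
  then obtain j H where j: "j < n" and H: "mono H"
    and le': "\<And>xs. length xs = n \<Longrightarrow> (gs ! i) xs \<le> H (xs ! j)"
    unfolding bounded_by_one_argument_def by auto
  show "oper n (\<lambda>xs. f (map (\<lambda>g. g xs) gs)) \<in> bounded_by_one_argument"
  proof (rule oper_bounded_by_one_argumentI[OF j])
    show "mono (\<lambda>x. G (H x))"
      using G H by (simp add: mono_def)
    fix xs :: "nat list" assume "length xs = n"
    then have "G ((gs ! i) xs) \<le> G (H (xs ! j))"
      by (intro monoD[OF G] le')
    then show "f (map (\<lambda>g. g xs) gs) \<le> G (H (xs ! j))"
      using le[of "map (\<lambda>g. g xs) gs"] i len by simp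
  qed
qed

lemma generated_subset_bounded_by_one_argument:
  "generated {sub_op, mod_op, pow2_op} \<subseteq> bounded_by_one_argument"
  unfolding generated_def
proof (rule hull_minimal, intro Un_least)
  have "sub_op \<in> bounded_by_one_argument" "mod_op \<in> bounded_by_one_argument"
    unfolding sub_op_def mod_op_def
    by (rule oper_bounded_by_one_argumentI[of 0 _ "\<lambda>x. x"]; simp add: mono_def)+
  moreover have "pow2_op \<in> bounded_by_one_argument"
    unfolding pow2_op_def
    by (rule oper_bounded_by_one_argumentI[of 0 _ "\<lambda>x. 2 ^ x"]; simp add: mono_def)
  ultimately show "{sub_op, mod_op, pow2_op} \<subseteq> bounded_by_one_argument"
    by simp
  \<comment> \<open>Constants have arity at least 1, so index 0 is available.\<close>
  show "constants \<subseteq> bounded_by_one_argument"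
    unfolding constants_def
    by (auto intro!: oper_bounded_by_one_argumentI[of 0 _ "\<lambda>_. c" for c] simp: mono_def)
  show "projections \<subseteq> bounded_by_one_argument"
    unfolding projections_def
    by (auto intro!: oper_bounded_by_one_argumentI[of _ _ "\<lambda>x. x"] simp: mono_def)
qed (rule closed_under_substitution_bounded_by_one_argument)

lemma add_op_not_bounded_by_one_argument: "add_op \<notin> bounded_by_one_argument"
proof
  assume "add_op \<in> bounded_by_one_argument"
  then obtain i and G :: "nat \<Rightarrow> nat" where i: "i < 2"
    and le: "\<And>xs. length xs = 2 \<Longrightarrow> xs ! 0 + xs ! 1 \<le> G (xs ! i)"
    unfolding bounded_by_one_argument_def add_op_def oper_def by auto
  \<comment> \<open>Whichever argument is supposed to control the sum is set to 0, and the other one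
    to \<open>Suc (G 0)\<close>, which exceeds the claimed bound \<open>G 0\<close>.\<close>
  show False
    using i le[of "[0, Suc (G 0)]"] le[of "[Suc (G 0), 0]"] by (auto simp: less_2_cases_iff)
qed

text \<open>A hull inherits a property that is stable under arbitrary intersections. Each of the
  three conditions is: it says that certain members of the set force a further member.\<close>

lemma kalmar_elementary_closed:
  "closed_under_substitution kalmar_elementary"
  "closed_under_bounded_sum kalmar_elementary"
  "closed_under_bounded_prod kalmar_elementary"
proof -
  let ?P = "\<lambda>S. closed_under_substitution S \<and> closed_under_bounded_sum S \<and> closed_under_bounded_prod S"
  have "?P kalmar_elementary"
    unfolding kalmar_elementary_def
  proof (rule hull_in)
    fix T assume "Ball T ?P"
    then have "Ball T closed_under_substitution" "Ball T closed_under_bounded_sum"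
      "Ball T closed_under_bounded_prod"
      by blast+
    then show "?P (\<Inter> T)"
      unfolding closed_under_substitution_def closed_under_bounded_sum_def
        closed_under_bounded_prod_def
      by (intro conjI) (simp; blast)+
  qed
  then show "closed_under_substitution kalmar_elementary"
    "closed_under_bounded_sum kalmar_elementary" "closed_under_bounded_prod kalmar_elementary"
    by auto
qed

lemma kalmar_elementary_basic:
  "constants \<union> projections \<union> {add_op, sub_op} \<subseteq> kalmar_elementary"
  unfolding kalmar_elementary_def by (rule hull_subset)

lemma kalmar_const: "1 \<le> n \<Longrightarrow> oper n (\<lambda>_. c) \<in> kalmar_elementary"
  using kalmar_elementary_basic unfolding constants_def by blast

lemma kalmar_nth: "i < n \<Longrightarrow> oper n (\<lambda>xs. xs ! i) \<in> kalmar_elementary"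
  using kalmar_elementary_basic unfolding projections_def by blast

lemma kalmar_subst2:
  assumes "oper 2 (\<lambda>xs. f (xs ! 0) (xs ! 1)) \<in> kalmar_elementary"
    and "oper n g \<in> kalmar_elementary" "oper n h \<in> kalmar_elementary"
  shows "oper n (\<lambda>xs. f (g xs) (h xs)) \<in> kalmar_elementary"
proof -
  have "oper (length [g, h]) (\<lambda>xs. f (xs ! 0) (xs ! 1)) \<in> kalmar_elementary"
    using assms(1) by (simp add: numeral_2_eq_2)
  from closed_under_substitutionD[OF kalmar_elementary_closed(1) this, of n] show ?thesis
    using assms(2,3) by auto
qed

lemma kalmar_add:
  assumes "oper n g \<in> kalmar_elementary" "oper n h \<in> kalmar_elementary"
  shows "oper n (\<lambda>xs. g xs + h xs) \<in> kalmar_elementary"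
  by (rule kalmar_subst2[OF _ assms]) (use kalmar_elementary_basic in \<open>auto simp: add_op_def\<close>)

lemma kalmar_diff:
  assumes "oper n g \<in> kalmar_elementary" "oper n h \<in> kalmar_elementary"
  shows "oper n (\<lambda>xs. g xs - h xs) \<in> kalmar_elementary"
  by (rule kalmar_subst2[OF _ assms]) (use kalmar_elementary_basic in \<open>auto simp: sub_op_def\<close>)

lemma last_conv_nth_length: "length xs = Suc k \<Longrightarrow> last xs = xs ! k"
  by (cases xs rule: rev_cases) auto

text \<open>Closure under bounded summation, made usable for an unrestricted \<open>f\<close>: the
  summand is evaluated only on lists of length \<open>Suc k\<close>, where the restriction is
  invisible.\<close>

lemma kalmar_sum:
  assumes "oper (Suc k) f \<in> kalmar_elementary"
  shows "oper (Suc k) (\<lambda>xs. \<Sum>z<xs ! k. f (take k xs @ [z])) \<in> kalmar_elementary"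
proof -
  have "(Suc k, snd (oper (Suc k) f)) \<in> kalmar_elementary"
    using assms by (simp add: oper_def)
  then have "oper (Suc k) (\<lambda>xs. \<Sum>z<last xs. snd (oper (Suc k) f) (butlast xs @ [z])) \<in> kalmar_elementary"
    using kalmar_elementary_closed(2) unfolding closed_under_bounded_sum_def by blast
  then show ?thesis
    by (subst oper_cong) (auto simp: oper_def butlast_conv_take last_conv_nth_length)
qed

lemma kalmar_prod:
  assumes "oper (Suc k) f \<in> kalmar_elementary"
  shows "oper (Suc k) (\<lambda>xs. \<Prod>z<xs ! k. f (take k xs @ [z])) \<in> kalmar_elementary"
proof -
  have "(Suc k, snd (oper (Suc k) f)) \<in> kalmar_elementary"
    using assms by (simp add: oper_def)
  then have "oper (Suc k) (\<lambda>xs. \<Prod>z<last xs. snd (oper (Suc k) f) (butlast xs @ [z])) \<in> kalmar_elementary"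
    using kalmar_elementary_closed(3) unfolding closed_under_bounded_prod_def by blast
  then show ?thesis
    by (subst oper_cong) (auto simp: oper_def butlast_conv_take last_conv_nth_length)
qed

lemma pow2_op_kalmar: "pow2_op \<in> kalmar_elementary"
  \<comment> \<open>Here the parameter list is empty (\<open>k = 0\<close>): a product of
    \<open>xs ! 0\<close> factors 2.\<close>
  using kalmar_prod[OF kalmar_const[of "Suc 0" 2]] by (simp add: pow2_op_def)

lemma kalmar_mult:
  assumes "oper n g \<in> kalmar_elementary" "oper n h \<in> kalmar_elementary"
  shows "oper n (\<lambda>xs. g xs * h xs) \<in> kalmar_elementary"
proof (rule kalmar_subst2[OF _ assms])
  \<comment> \<open>Multiplication as repeated addition: the summand ignores \<open>z\<close> and
    picks the first argument.\<close>
  have "oper 2 (\<lambda>xs. \<Sum>z<xs ! 1. (take 1 xs @ [z]) ! 0) \<in> kalmar_elementary"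
    using kalmar_sum[OF kalmar_nth[of 0 "Suc 1"]] by (simp add: numeral_2_eq_2)
  also have "oper 2 (\<lambda>xs. \<Sum>z<xs ! 1. (take 1 xs @ [z]) ! 0) = oper 2 (\<lambda>xs. xs ! 0 * xs ! 1)"
    by (rule oper_cong) (simp add: nth_append)
  finally show "oper 2 (\<lambda>xs. xs ! 0 * xs ! 1) \<in> kalmar_elementary" .
qed

text \<open>For \<open>y > 0\<close> the factor \<open>1 - (y * z + y - x)\<close> is, by
  truncation, the indicator of \<open>y * Suc z \<le> x\<close>, that is, of
  \<open>z < x div y\<close>. Since \<open>x div y \<le> x\<close>, the range \<open>z < x\<close>
  contains all such \<open>z\<close>. For \<open>y = 0\<close> both sides vanish.\<close>

lemma mult_div_eq_sum:
  fixes x y :: nat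
  shows "y * (x div y) = (\<Sum>z<x. y * (1 - (y * z + y - x)))"
proof (cases "y = 0")
  case False
  have "1 - (y * z + y - x) = (if z < x div y then 1 else 0)" for z
    using False less_eq_div_iff_mult_less_eq[of y "Suc z" x] by (auto simp: algebra_simps Suc_le_eq)
  then have "(\<Sum>z<x. y * (1 - (y * z + y - x))) = y * card ({..<x} \<inter> {z. z < x div y})"
    by (simp add: sum_distrib_left[symmetric] sum.If_cases)
  moreover have "{..<x} \<inter> {z. z < x div y} = {..<x div y}"
    using order_less_le_trans[OF _ div_le_dividend[of x y]] by blast
  ultimately show ?thesis by simp
qed simp

lemma mod_op_kalmar: "mod_op \<in> kalmar_elementary"
proof -
  define f :: "nat list \<Rightarrow> nat"
    where "f = (\<lambda>xs. xs ! 1 * (1 - (xs ! 1 * xs ! 2 + xs ! 1 - xs ! 0)))"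
  have "oper (Suc 2) f \<in> kalmar_elementary"
    unfolding f_def by (intro kalmar_mult kalmar_diff kalmar_add kalmar_const kalmar_nth) simp_all
  from kalmar_sum[OF this]
  \<comment> \<open>Bounded summation yields a ternary operation whose third argument is the bound.
    Substituting \<open>xs ! 0\<close> for that argument makes the bound equal to the
    dividend.\<close>
  have "oper (length [\<lambda>xs. xs ! 0, \<lambda>xs. xs ! 1, \<lambda>xs. xs ! 0 :: nat])
      (\<lambda>xs. \<Sum>z<xs ! 2. f (take 2 xs @ [z])) \<in> kalmar_elementary"
    by (simp add: eval_nat_numeral)
  from closed_under_substitutionD[OF kalmar_elementary_closed(1) this, of 2]
  have "oper 2 (\<lambda>xs. \<Sum>z<xs ! 0. f [xs ! 0, xs ! 1, z]) \<in> kalmar_elementary"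
    using kalmar_nth[of 0 2] kalmar_nth[of 1 2] by auto
  moreover have "(\<Sum>z<x. f [x, y, z]) = y * (x div y)" for x y
    unfolding mult_div_eq_sum by (simp add: f_def)
  ultimately have "oper 2 (\<lambda>xs. xs ! 1 * (xs ! 0 div xs ! 1)) \<in> kalmar_elementary"
    by simp
  from kalmar_diff[OF kalmar_nth[of 0 2] this]
  have "oper 2 (\<lambda>xs. xs ! 0 - xs ! 1 * (xs ! 0 div xs ! 1)) \<in> kalmar_elementary"
    by simp
  \<comment> \<open>The identity behind this also covers \<open>y = 0\<close>, where nothing is
    subtracted and \<open>x mod 0 = x\<close>.\<close>
  then show ?thesis
    by (simp add: mod_op_def minus_mult_div_eq_mod)
qed

theorem corollary14:
  "generated {sub_op, mod_op, pow2_op} \<subset> kalmar_elementary"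
proof (rule psubsetI)
  show "generated {sub_op, mod_op, pow2_op} \<subseteq> kalmar_elementary"
    unfolding generated_def
    by (rule hull_minimal)
      (use kalmar_elementary_basic kalmar_elementary_closed(1) mod_op_kalmar pow2_op_kalmar in auto)
  show "generated {sub_op, mod_op, pow2_op} \<noteq> kalmar_elementary"
    using generated_subset_bounded_by_one_argument add_op_not_bounded_by_one_argument
      kalmar_elementary_basic by auto
qed

end
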